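(* Let $M$ be a smooth manifold and $\Theta\in\Omega^n(M)$. The graded Jacobi bracket satisfies the weak Leibniz rule: for every pair of conformal Hamiltonian forms $\alpha\in\Omega^a(M)$ and $\beta\in\Omega^b(M)$, $$\operatorname{Supp}\{\alpha,\beta\}\subseteq\operatorname{Supp}\alpha\cap\operatorname{Supp}\beta,$$ where $\operatorname{Supp}$ denotes the support of a form.
   Context: $\mathfrak{X}^p(M)=\Gamma(\bigwedge^p TM)$. Conventions: $\iota_{U\wedge V}=\iota_V\iota_U$; for $U\in\mathfrak{X}^p(M)$, $\mathcal{L}_U\alpha=d\iota_U\alpha-(-1)^p\iota_U d\alpha$; the Schouten--Nijenhuis bracket of $U\in\mathfrak{X}^p(M)$, $V\in\mathfrak{X}^q(M)$ is normalized by $\iota_{[U,V]}=(-1)^{(p-1)q}\mathcal{L}_U\iota_V-\iota_V\mathcal{L}_U$. Forms of negative degree are zero. For $1\le p\le n$, $X\in\mathfrak{X}^p(M)$ is an infinitesimal conformal transformation of $\Theta$ if $\mathcal{L}_X\Theta=\iota_V\Theta$ for some $V\in\mathfrak{X}^{p-1}(M)$. A form $\alpha\in\Omega^{n-p}(M)$ is conformal Hamiltonian if $\iota_{X_\alpha}\Theta=-\alpha$ for some infinitesimal conformal transformation $X_\alpha\in\mathfrak{X}^p(M)$. The graded Jacobi bracket is $\{\alpha,\beta\}:=-\iota_{[X_\alpha,X_\beta]}\Theta$, independent of the choice of $X_\alpha,X_\beta$. *)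

theory Defs
  imports "HOL-Analysis.Analysis"
begin

section \<open>Smooth manifolds\<close>

text \<open>A map is smooth on an open set if all iterated directional derivatives exist and are
  continuous.\<close>

primrec Ck_on :: "nat \<Rightarrow> 'e::real_normed_vector set \<Rightarrow> ('e \<Rightarrow> 'f::real_normed_vector) \<Rightarrow> bool" where
  "Ck_on 0 S f \<longleftrightarrow> continuous_on S f"
| "Ck_on (Suc k) S f \<longleftrightarrow>
     (\<forall>x\<in>S. f differentiable (at x)) \<and> (\<forall>v. Ck_on k S (\<lambda>x. frechet_derivative f (at x) v))"

definition smooth_on :: "'e::real_normed_vector set \<Rightarrow> ('e \<Rightarrow> 'f::real_normed_vector) \<Rightarrow> bool" where
  "smooth_on S f \<longleftrightarrow> (\<forall>k. Ck_on k S f)"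

text \<open>A chart is a pair of a domain in the manifold and a coordinate map, whose values off the
  domain are irrelevant.\<close>

type_synonym ('a, 'e) chart = "'a set \<times> ('a \<Rightarrow> 'e)"

definition chart_image :: "('a, 'e) chart \<Rightarrow> 'e set" where
  "chart_image c = snd c ` fst c"

definition chart_on :: "'a topology \<Rightarrow> ('a, 'e::real_normed_vector) chart \<Rightarrow> bool" where
  "chart_on M c \<longleftrightarrow> openin M (fst c) \<and> open (chart_image c) \<and>
     homeomorphic_map (subtopology M (fst c)) (top_of_set (chart_image c)) (snd c)"

definition overlap :: "('a, 'e) chart \<Rightarrow> ('a, 'e) chart \<Rightarrow> 'e set" where
  "overlap c c' = snd c ` (fst c \<inter> fst c')"

definition transition :: "('a, 'e) chart \<Rightarrow> ('a, 'e) chart \<Rightarrow> 'e \<Rightarrow> 'e" where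
  "transition c c' = snd c' \<circ> inv_into (fst c) (snd c)"

text \<open>The smooth structure is given by any (not necessarily maximal) smooth atlas.  The model space
  is a finite-dimensional normed space rather than a \<open>euclidean_space\<close>, because the latter class
  excludes dimension 0.\<close>

definition smooth_manifold :: "'a topology \<Rightarrow> ('a, 'e::real_normed_vector) chart set \<Rightarrow> bool" where
  "smooth_manifold M A \<longleftrightarrow>
     (\<exists>B::'e set. finite B \<and> span B = UNIV) \<and>
     Hausdorff_space M \<and> second_countable M \<and>
     (\<forall>c\<in>A. chart_on M c) \<and> (\<Union>c\<in>A. fst c) = topspace M \<and>
     (\<forall>c\<in>A. \<forall>c'\<in>A. smooth_on (overlap c c') (transition c c'))"


section \<open>Differential forms\<close>

text \<open>Alternating \<open>k\<close>-linear forms, as functions of argument lists that vanish on lists of any other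
  length.\<close>

definition alternating_forms :: "nat \<Rightarrow> ('e::real_vector list \<Rightarrow> real) set" where
  "alternating_forms k = {f.
     (\<forall>vs. length vs \<noteq> k \<longrightarrow> f vs = 0) \<and>
     (\<forall>us ws. length us + length ws + 1 = k \<longrightarrow> linear (\<lambda>v. f (us @ v # ws))) \<and>
     (\<forall>vs. \<not> distinct vs \<longrightarrow> f vs = 0)}"

text \<open>A form is the family of its coordinate expressions: \<open>\<omega> c x vs\<close> is the value, at the point with
  coordinates \<open>x\<close> in the chart \<open>c\<close>, on the tangent vectors with components \<open>vs\<close>.  The expressions
  have to agree under pullback along transition maps.  They are 0 where they carry no information,
  so that equality of forms is equality of functions.\<close>

type_synonym ('a, 'e) form = "('a, 'e) chart \<Rightarrow> 'e \<Rightarrow> 'e list \<Rightarrow> real"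

definition forms :: "('a, 'e::real_normed_vector) chart set \<Rightarrow> nat \<Rightarrow> ('a, 'e) form set" where
  "forms A k = {\<omega>.
     (\<forall>c x. c \<notin> A \<or> x \<notin> chart_image c \<longrightarrow> \<omega> c x = (\<lambda>_. 0)) \<and>
     (\<forall>c\<in>A. (\<forall>x\<in>chart_image c. \<omega> c x \<in> alternating_forms k) \<and>
            (\<forall>vs. smooth_on (chart_image c) (\<lambda>x. \<omega> c x vs))) \<and>
     (\<forall>c\<in>A. \<forall>c'\<in>A. \<forall>x\<in>overlap c c'.
        \<omega> c x = (\<lambda>vs. \<omega> c' (transition c c' x)
                          (map (frechet_derivative (transition c c') (at x)) vs)))}"

definition exterior_derivative :: "('a, 'e::real_normed_vector) form \<Rightarrow> ('a, 'e) form" where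
  "exterior_derivative \<omega> = (\<lambda>c x vs.
     if x \<in> chart_image c
     then \<Sum>i<length vs. (-1) ^ i *
            frechet_derivative (\<lambda>y. \<omega> c y (take i vs @ drop (Suc i) vs)) (at x) (vs ! i)
     else 0)"

definition support :: "'a topology \<Rightarrow> ('a, 'e) chart set \<Rightarrow> ('a, 'e) form \<Rightarrow> 'a set" where
  "support M A \<omega> = M closure_of
     {m \<in> topspace M. \<exists>c\<in>A. m \<in> fst c \<and> \<omega> c (snd c m) \<noteq> (\<lambda>_. 0)}"


section \<open>Multivector fields\<close>

text \<open>The exterior power \<open>\<Lambda>\<^sup>p E\<close> of a finite-dimensional space \<open>E\<close> is spanned by the decomposable
  elements \<open>u\<^sub>1 \<and> \<dots> \<and> u\<^sub>p\<close>, and it embeds into the dual of the alternating \<open>p\<close>-forms,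
  where \<open>u\<^sub>1 \<and> \<dots> \<and> u\<^sub>p\<close> acts as \<open>f \<mapsto> f(u\<^sub>1, \<dots>, u\<^sub>p)\<close>.  A \<open>p\<close>-vector is represented by this
  action; values on functions that are not alternating \<open>p\<close>-forms carry no information.\<close>

definition multivectors :: "nat \<Rightarrow> (('e::real_vector list \<Rightarrow> real) \<Rightarrow> real) set" where
  "multivectors p = {L. \<exists>S a. finite S \<and> (\<forall>us\<in>S. length us = p) \<and>
     (\<forall>f\<in>alternating_forms p. L f = (\<Sum>us\<in>S. a us * f us))}"

type_synonym ('a, 'e) mvfield = "('a, 'e) chart \<Rightarrow> 'e \<Rightarrow> ('e list \<Rightarrow> real) \<Rightarrow> real"

definition mvfields :: "('a, 'e::real_normed_vector) chart set \<Rightarrow> nat \<Rightarrow> ('a, 'e) mvfield set" where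
  "mvfields A p = {U.
     (\<forall>c x. c \<notin> A \<or> x \<notin> chart_image c \<longrightarrow> U c x = (\<lambda>_. 0)) \<and>
     (\<forall>c\<in>A. (\<forall>x\<in>chart_image c. U c x \<in> multivectors p) \<and>
            (\<forall>f\<in>alternating_forms p. smooth_on (chart_image c) (\<lambda>x. U c x f))) \<and>
     (\<forall>c\<in>A. \<forall>c'\<in>A. \<forall>x\<in>overlap c c'. \<forall>f\<in>alternating_forms p.
        U c' (transition c c' x) f =
        U c x (\<lambda>us. f (map (frechet_derivative (transition c c') (at x)) us)))}"

text \<open>\<open>\<iota>\<^sub>U \<omega> = \<omega>(u\<^sub>1, \<dots>, u\<^sub>p, \<cdot>)\<close> for \<open>U = u\<^sub>1 \<and> \<dots> \<and> u\<^sub>p\<close>, which is the convention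
  \<open>\<iota>\<^sub>U\<^sub>\<and>\<^sub>V = \<iota>\<^sub>V \<iota>\<^sub>U\<close>.  For a \<open>k\<close>-form with \<open>k < p\<close> the result is 0, because \<open>us @ vs\<close> never has
  length \<open>k\<close>.\<close>

definition interior_product ::
  "nat \<Rightarrow> ('a, 'e) mvfield \<Rightarrow> ('a, 'e) form \<Rightarrow> ('a, 'e) form" where
  "interior_product p U \<omega> =
     (\<lambda>c x vs. U c x (\<lambda>us. if length us = p then \<omega> c x (us @ vs) else 0))"

definition lie_derivative ::
  "nat \<Rightarrow> ('a, 'e::real_normed_vector) mvfield \<Rightarrow> ('a, 'e) form \<Rightarrow> ('a, 'e) form" where
  "lie_derivative p U \<omega> = (\<lambda>c x vs.
     exterior_derivative (interior_product p U \<omega>) c x vs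
     - (-1) ^ p * interior_product p U (exterior_derivative \<omega>) c x vs)"

text \<open>\<open>W = [U, V]\<close>.  The bracket is introduced through its normalization, which determines the
  multivector field \<open>W\<close> uniquely, and is expressed as a relation.  Natural-number subtraction is harmless since only degrees
  \<open>p, q \<ge> 1\<close> are used.\<close>

definition schouten_bracket ::
  "('a, 'e::real_normed_vector) chart set \<Rightarrow> nat \<Rightarrow> nat \<Rightarrow>
   ('a, 'e) mvfield \<Rightarrow> ('a, 'e) mvfield \<Rightarrow> ('a, 'e) mvfield \<Rightarrow> bool" where
  "schouten_bracket A p q U V W \<longleftrightarrow> W \<in> mvfields A (p + q - 1) \<and>
     (\<forall>k. \<forall>\<omega>\<in>forms A k.
        interior_product (p + q - 1) W \<omega> = (\<lambda>c x vs.
          (-1) ^ ((p - 1) * q) * lie_derivative p U (interior_product q V \<omega>) c x vs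
          - interior_product q V (lie_derivative p U \<omega>) c x vs))"


section \<open>Conformal Hamiltonian forms and the graded Jacobi bracket\<close>

definition infinitesimal_conformal ::
  "('a, 'e::real_normed_vector) chart set \<Rightarrow> nat \<Rightarrow> ('a, 'e) form \<Rightarrow>
   nat \<Rightarrow> ('a, 'e) mvfield \<Rightarrow> bool" where
  "infinitesimal_conformal A n \<Theta> p X \<longleftrightarrow> 1 \<le> p \<and> p \<le> n \<and> X \<in> mvfields A p \<and>
     (\<exists>V\<in>mvfields A (p - 1). lie_derivative p X \<Theta> = interior_product (p - 1) V \<Theta>)"

text \<open>\<open>X\<close> is a possible choice of \<open>X\<^sub>\<alpha>\<close>.\<close>

definition hamiltonian_mvfield ::
  "('a, 'e::real_normed_vector) chart set \<Rightarrow> nat \<Rightarrow> ('a, 'e) form \<Rightarrow>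
   nat \<Rightarrow> ('a, 'e) form \<Rightarrow> ('a, 'e) mvfield \<Rightarrow> bool" where
  "hamiltonian_mvfield A n \<Theta> p \<alpha> X \<longleftrightarrow> \<alpha> \<in> forms A (n - p) \<and>
     infinitesimal_conformal A n \<Theta> p X \<and>
     interior_product p X \<Theta> = (\<lambda>c x vs. - \<alpha> c x vs)"

definition conformal_hamiltonian ::
  "('a, 'e::real_normed_vector) chart set \<Rightarrow> nat \<Rightarrow> ('a, 'e) form \<Rightarrow>
   nat \<Rightarrow> ('a, 'e) form \<Rightarrow> bool" where
  "conformal_hamiltonian A n \<Theta> a \<alpha> \<longleftrightarrow>
     (\<exists>p X. p \<le> n \<and> a = n - p \<and> hamiltonian_mvfield A n \<Theta> p \<alpha> X)"

text \<open>\<open>\<gamma> = {\<alpha>, \<beta>}\<close>, for any admissible choice of \<open>X\<^sub>\<alpha>\<close> and \<open>X\<^sub>\<beta>\<close>.\<close>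

definition graded_jacobi_bracket ::
  "('a, 'e::real_normed_vector) chart set \<Rightarrow> nat \<Rightarrow> ('a, 'e) form \<Rightarrow>
   nat \<Rightarrow> ('a, 'e) form \<Rightarrow> nat \<Rightarrow> ('a, 'e) form \<Rightarrow> ('a, 'e) form \<Rightarrow> bool" where
  "graded_jacobi_bracket A n \<Theta> a \<alpha> b \<beta> \<gamma> \<longleftrightarrow>
     (\<exists>p q X Y W. p \<le> n \<and> q \<le> n \<and> a = n - p \<and> b = n - q \<and>
        hamiltonian_mvfield A n \<Theta> p \<alpha> X \<and> hamiltonian_mvfield A n \<Theta> q \<beta> Y \<and>
        schouten_bracket A p q X Y W \<and>
        \<gamma> = (\<lambda>c x vs. - interior_product (p + q - 1) W \<Theta> c x vs))"

end

theory Submission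
  imports Defs
begin

text \<open>Let \<open>X\<close> and \<open>Y\<close>, of degrees \<open>p\<close> and \<open>q\<close>, be the multivector fields of \<open>\<alpha>\<close> and \<open>\<beta>\<close>, with
  \<open>\<L>\<^sub>X \<Theta> = \<iota>\<^sub>V \<Theta>\<close> and \<open>\<L>\<^sub>Y \<Theta> = \<iota>\<^sub>V\<^sub>' \<Theta>\<close>.  The normalization of the Schouten bracket gives
  \<open>-\<gamma> = (-1)\<^bsup>(p-1)q\<^esup> \<L>\<^sub>X \<iota>\<^sub>Y \<Theta> - \<iota>\<^sub>Y \<L>\<^sub>X \<Theta>\<close>, where \<open>\<iota>\<^sub>X \<Theta> = -\<alpha>\<close> and \<open>\<iota>\<^sub>Y \<Theta> = -\<beta>\<close>.
  The claim is local: it suffices that the right-hand side vanishes on every open subset of a chart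
  on which \<open>\<alpha>\<close> or \<open>\<beta>\<close> does.  The tools are the locality of \<open>d\<close> and the graded commutation
  \<open>\<iota>\<^sub>X \<iota>\<^sub>Y = (-1)\<^bsup>pq\<^esup> \<iota>\<^sub>Y \<iota>\<^sub>X\<close>.

  Where \<open>\<beta> = 0\<close>, the first term vanishes because \<open>\<L>\<^sub>X\<close> is local, and the second is
  \<open>\<iota>\<^sub>Y \<iota>\<^sub>V \<Theta> = \<plusminus>\<iota>\<^sub>V \<iota>\<^sub>Y \<Theta> = 0\<close>.

  Where \<open>\<alpha> = 0\<close>, neither term need vanish, but they cancel.  There
  \<open>\<L>\<^sub>X \<Theta> = -(-1)\<^sup>p \<iota>\<^sub>X d\<Theta>\<close>, and also \<open>\<iota>\<^sub>X \<iota>\<^sub>Y \<Theta> = \<plusminus>\<iota>\<^sub>Y \<iota>\<^sub>X \<Theta> = 0\<close>, so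
  \<open>\<L>\<^sub>X \<iota>\<^sub>Y \<Theta> = -(-1)\<^sup>p \<iota>\<^sub>X d\<iota>\<^sub>Y \<Theta>\<close>.  Because \<open>Y\<close> is conformal,
  \<open>d\<iota>\<^sub>Y \<Theta> = \<iota>\<^sub>V\<^sub>' \<Theta> + (-1)\<^sup>q \<iota>\<^sub>Y d\<Theta>\<close>, and \<open>\<iota>\<^sub>X\<close> kills the first summand by commuting past
  \<open>\<iota>\<^sub>V\<^sub>'\<close>.  Both terms are thus multiples of \<open>\<iota>\<^sub>Y \<iota>\<^sub>X d\<Theta>\<close>, and the signs match.
  Commuting \<open>\<iota>\<^sub>X\<close> and \<open>\<iota>\<^sub>Y\<close> on \<open>d\<Theta>\<close> is legitimate only because the coordinate formula for \<open>d\<close>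
  produces alternating forms; this is the one substantial computation.\<close>

section \<open>Alternating forms and contraction at a point\<close>

lemma alternating_forms_linear:
  "f \<in> alternating_forms k \<Longrightarrow> length us + length ws + 1 = k \<Longrightarrow> linear (\<lambda>v. f (us @ v # ws))"
  by (auto simp: alternating_forms_def)

lemma alternating_forms_length: "f \<in> alternating_forms k \<Longrightarrow> length vs \<noteq> k \<Longrightarrow> f vs = 0"
  by (auto simp: alternating_forms_def)

lemma alternating_forms_not_distinct: "f \<in> alternating_forms k \<Longrightarrow> \<not> distinct vs \<Longrightarrow> f vs = 0"
  by (auto simp: alternating_forms_def)

lemma zero_alternating: "(\<lambda>_. 0) \<in> alternating_forms k"
  by (auto simp: alternating_forms_def linear_iff)

lemma linear_combination_alternating:
  assumes "\<And>i. i \<in> I \<Longrightarrow> g i \<in> alternating_forms k"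
  shows "(\<lambda>vs. \<Sum>i\<in>I. a i * g i vs) \<in> alternating_forms k"
proof -
  have "linear (\<lambda>v. \<Sum>i\<in>I. a i * g i (us @ v # ws))" if "length us + length ws + 1 = k" for us ws
  proof (rule linear_compose_sum, rule ballI)
    fix i assume "i \<in> I"
    then have "linear (\<lambda>v. g i (us @ v # ws))"
      using assms that alternating_forms_linear by blast
    then show "linear (\<lambda>v. a i * g i (us @ v # ws))"
      by (simp add: linear_iff algebra_simps)
  qed
  then show ?thesis
    using assms by (auto simp: alternating_forms_def intro!: sum.neutral)
qed

lemma alternating_add_scaled:
  assumes "f \<in> alternating_forms k" "g \<in> alternating_forms k"
  shows "(\<lambda>vs. f vs + (r::real) * g vs) \<in> alternating_forms k"
  using assms unfolding alternating_forms_def linear_iff mem_Collect_eq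
  by (simp add: algebra_simps)

text \<open>Polarization: the form vanishes when the two adjacent arguments are both \<open>a + b\<close>, both
  \<open>a\<close> or both \<open>b\<close>, so the two mixed terms of the expansion add up to 0.\<close>

lemma alternating_swap_adjacent:
  assumes f: "f \<in> alternating_forms k"
  shows "f (xs @ a # b # ys) = - f (xs @ b # a # ys)"
proof (cases "length (xs @ a # b # ys) = k")
  case True
  have l1: "linear (\<lambda>v. f (xs @ v # w # ys))" for w
    using alternating_forms_linear[OF f, of xs "w # ys"] True by simp
  have l2: "linear (\<lambda>v. f (xs @ w # v # ys))" for w
    using alternating_forms_linear[OF f, of "xs @ [w]" ys] True by simp
  have z: "f (xs @ w # w # ys) = 0" for w
    by (rule alternating_forms_not_distinct[OF f]) simp
  have "f (xs @ (a + b) # (a + b) # ys)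
      = f (xs @ a # a # ys) + f (xs @ b # a # ys) + (f (xs @ a # b # ys) + f (xs @ b # b # ys))"
    using linear_add[OF l1] linear_add[OF l2] by simp
  then show ?thesis by (simp add: z)
next
  case False
  then show ?thesis using alternating_forms_length[OF f] by simp
qed

lemma alternating_move:
  assumes f: "f \<in> alternating_forms k"
  shows "f (xs @ a # ws @ ys) = (-1) ^ length ws * f (xs @ ws @ a # ys)"
proof (induction ws arbitrary: xs)
  case Nil
  then show ?case by simp
next
  case (Cons w ws)
  have "f (xs @ a # w # ws @ ys) = - f ((xs @ [w]) @ a # ws @ ys)"
    using alternating_swap_adjacent[OF f, of xs a w "ws @ ys"] by simp
  then show ?case using Cons[of "xs @ [w]"] by simp
qed

lemma alternating_swap_blocks:
  assumes f: "f \<in> alternating_forms k"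
  shows "f (xs @ us @ ws @ ys) = (-1) ^ (length us * length ws) * f (xs @ ws @ us @ ys)"
proof (induction us arbitrary: xs)
  case Nil
  then show ?case by simp
next
  case (Cons u us)
  have "f (xs @ u # us @ ws @ ys) = (-1) ^ (length us * length ws) * f (xs @ u # ws @ us @ ys)"
    using Cons[of "xs @ [u]"] by simp
  also have "f (xs @ u # ws @ us @ ys) = (-1) ^ length ws * f (xs @ ws @ u # us @ ys)"
    by (rule alternating_move[OF f])
  finally show ?case by (simp add: power_add)
qed

definition contract ::
  "nat \<Rightarrow> (('e list \<Rightarrow> real) \<Rightarrow> real) \<Rightarrow> ('e list \<Rightarrow> real) \<Rightarrow> 'e list \<Rightarrow> real" where
  "contract p L f = (\<lambda>vs. L (\<lambda>us. if length us = p then f (us @ vs) else 0))"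

lemma interior_product_contract:
  "interior_product p U \<omega> c x = contract p (U c x) (\<omega> c x)"
  by (simp add: interior_product_def contract_def)

lemma partial_evaluation_alternating:
  assumes f: "f \<in> alternating_forms k"
  shows "(\<lambda>us. if length us = p then f (us @ vs) else 0) \<in> alternating_forms p"
proof -
  have "linear (\<lambda>v. f (us @ v # ws @ vs))" if "length us + length ws + 1 = p" for us ws
  proof (cases "p + length vs = k")
    case True
    then show ?thesis using that by (intro alternating_forms_linear[OF f]) simp
  next
    case False
    then have "f (us @ v # ws @ vs) = 0" for v
      using that by (intro alternating_forms_length[OF f]) simp
    then show ?thesis by (simp add: linear_iff)
  qed
  then show ?thesis
    using alternating_forms_not_distinct[OF f] by (auto simp: alternating_forms_def)
qed

text \<open>A multivector is a formal combination of decomposables, and one such combination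
  computes its contraction with alternating forms of every degree.  Linearity and commutation of
  contractions then become statements about sums.\<close>

lemma contract_representation:
  assumes "L \<in> multivectors p"
  shows "\<exists>S a. (\<forall>us\<in>S. length us = p) \<and>
    (\<forall>k. \<forall>f\<in>alternating_forms k. \<forall>vs. contract p L f vs = (\<Sum>us\<in>S. a us * f (us @ vs)))"
proof -
  obtain S a where S: "\<forall>us\<in>S. length us = p"
    "\<forall>f\<in>alternating_forms p. L f = (\<Sum>us\<in>S. a us * f us)"
    using assms unfolding multivectors_def by blast
  have "contract p L f vs = (\<Sum>us\<in>S. a us * f (us @ vs))" if "f \<in> alternating_forms k" for k f vs
    using S partial_evaluation_alternating[OF that, of p vs] by (simp add: contract_def)
  with S(1) show ?thesis by (intro exI[of _ S] exI[of _ a]) simp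
qed

lemma contract_zero:
  assumes "L \<in> multivectors p"
  shows "contract p L (\<lambda>_. 0) = (\<lambda>_. 0)"
proof -
  obtain S a where "\<forall>us\<in>S. length us = p"
    and r: "\<forall>k. \<forall>f\<in>alternating_forms k. \<forall>vs. contract p L f vs = (\<Sum>us\<in>S. a us * f (us @ vs))"
    using contract_representation[OF assms] by metis
  note r = r[rule_format]
  from r[OF zero_alternating] show ?thesis by auto
qed

lemma contract_add_scaled:
  assumes "L \<in> multivectors p" "f \<in> alternating_forms k" "g \<in> alternating_forms k"
  shows "contract p L (\<lambda>vs. f vs + r * g vs) vs = contract p L f vs + r * contract p L g vs"
proof -
  obtain S a where "\<forall>us\<in>S. length us = p"
    and r: "\<forall>k. \<forall>f\<in>alternating_forms k. \<forall>vs. contract p L f vs = (\<Sum>us\<in>S. a us * f (us @ vs))"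
    using contract_representation[OF assms(1)] by metis
  note r = r[rule_format]
  show ?thesis
    by (simp add: r[OF alternating_add_scaled[OF assms(2,3)]] r[OF assms(2)] r[OF assms(3)]
        sum.distrib sum_distrib_left algebra_simps)
qed

lemma contract_alternating:
  assumes L: "L \<in> multivectors p" and f: "f \<in> alternating_forms k"
  shows "contract p L f \<in> alternating_forms (k - p)"
proof -
  obtain S a where S: "\<forall>us\<in>S. length us = p"
    and r: "\<forall>k. \<forall>f\<in>alternating_forms k. \<forall>vs. contract p L f vs = (\<Sum>us\<in>S. a us * f (us @ vs))"
    using contract_representation[OF L] by metis
  note S = S[rule_format] and r = r[rule_format]
  have "(\<lambda>vs. f (us @ vs)) \<in> alternating_forms (k - p)" if "us \<in> S" for us
  proof -
    have "linear (\<lambda>v. f (us @ xs @ v # ws))" if "length xs + length ws + 1 = k - p" for xs ws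
      using alternating_forms_linear[OF f, of "us @ xs" ws] that S[OF \<open>us \<in> S\<close>] by simp
    \<comment> \<open>For \<open>p > k\<close> the truncated degree \<open>k - p\<close> is 0, and the partial evaluation is the zero
      form because \<open>us\<close> alone is too long.\<close>
    moreover have "f (us @ vs) = 0" if "length vs \<noteq> k - p" for vs
      using alternating_forms_length[OF f, of "us @ vs"] that S[OF \<open>us \<in> S\<close>] by force
    ultimately show ?thesis
      using alternating_forms_not_distinct[OF f] by (auto simp: alternating_forms_def)
  qed
  then have "(\<lambda>vs. \<Sum>us\<in>S. a us * f (us @ vs)) \<in> alternating_forms (k - p)"
    by (rule linear_combination_alternating)
  moreover have "contract p L f = (\<lambda>vs. \<Sum>us\<in>S. a us * f (us @ vs))"
    by (rule ext) (rule r[OF f])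
  ultimately show ?thesis by simp
qed

text \<open>On decomposable multivectors the two sides evaluate \<open>f\<close> on lists that differ by exchanging
  a block of length \<open>p\<close> with one of length \<open>q\<close>.\<close>

lemma contract_graded_commute:
  assumes K: "K \<in> multivectors p" and L: "L \<in> multivectors q" and f: "f \<in> alternating_forms k"
  shows "contract p K (contract q L f) vs = (-1) ^ (p * q) * contract q L (contract p K f) vs"
proof -
  obtain S a where S: "\<forall>us\<in>S. length us = p"
    and K': "\<forall>k. \<forall>f\<in>alternating_forms k. \<forall>vs. contract p K f vs = (\<Sum>us\<in>S. a us * f (us @ vs))"
    using contract_representation[OF K] by metis
  note S = S[rule_format] and K' = K'[rule_format]
  obtain T b where T: "\<forall>us\<in>T. length us = q"
    and L': "\<forall>k. \<forall>f\<in>alternating_forms k. \<forall>vs. contract q L f vs = (\<Sum>us\<in>T. b us * f (us @ vs))"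
    using contract_representation[OF L] by metis
  note T = T[rule_format] and L' = L'[rule_format]
  have "contract p K (contract q L f) vs = (\<Sum>us\<in>S. \<Sum>ws\<in>T. a us * (b ws * f (ws @ us @ vs)))"
    by (simp add: K'[OF contract_alternating[OF L f]] L'[OF f] sum_distrib_left)
  also have "\<dots> = (\<Sum>us\<in>S. \<Sum>ws\<in>T. a us * (b ws * ((-1) ^ (p * q) * f (us @ ws @ vs))))"
  proof (intro sum.cong refl)
    fix us ws assume "us \<in> S" "ws \<in> T"
    then show "a us * (b ws * f (ws @ us @ vs)) = a us * (b ws * ((-1) ^ (p * q) * f (us @ ws @ vs)))"
      using alternating_swap_blocks[OF f, of "[]" ws us vs] S T by (simp add: mult.commute)
  qed
  also have "\<dots> = (\<Sum>ws\<in>T. \<Sum>us\<in>S. a us * (b ws * ((-1) ^ (p * q) * f (us @ ws @ vs))))"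
    by (rule sum.swap)
  also have "\<dots> = (-1) ^ (p * q) * contract q L (contract p K f) vs"
    by (simp add: L'[OF contract_alternating[OF K f]] K'[OF f] sum_distrib_left algebra_simps)
  finally show ?thesis .
qed

section \<open>The exterior derivative in a chart\<close>

lemma exterior_derivative_local_zero:
  assumes N: "open N" "x \<in> N" and z: "\<And>y. y \<in> N \<Longrightarrow> \<omega> c y = (\<lambda>_. 0)"
  shows "exterior_derivative \<omega> c x = (\<lambda>_. 0)"
proof -
  have "frechet_derivative (\<lambda>y. \<omega> c y ws) (at x) = (\<lambda>_. 0)" for ws
  proof -
    have "((\<lambda>y. \<omega> c y ws) has_derivative (\<lambda>_. 0)) (at x)"
      by (rule has_derivative_transform_within_open[OF has_derivative_const[of 0] N])
        (simp add: z)
    then show ?thesis by (rule frechet_derivative_at[symmetric])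
  qed
  then show ?thesis by (auto simp: exterior_derivative_def)
qed

text \<open>Differentiating in the base point preserves linearity in a parameter.  This makes the
  derivative of a form multilinear in its arguments.\<close>

lemma linear_frechet_derivative_of_family:
  assumes lin: "\<And>y. linear (\<lambda>v. g y v :: real)"
    and d: "\<And>v. (\<lambda>y. g y v) differentiable (at x)"
  shows "linear (\<lambda>v. frechet_derivative (\<lambda>y. g y v) (at x) h)"
proof (rule linearI)
  fix u v
  have "((\<lambda>y. g y u + g y v) has_derivative
      (\<lambda>h. frechet_derivative (\<lambda>y. g y u) (at x) h + frechet_derivative (\<lambda>y. g y v) (at x) h)) (at x)"
    using d by (intro has_derivative_add) (auto simp: frechet_derivative_works[symmetric])
  then show "frechet_derivative (\<lambda>y. g y (u + v)) (at x) h =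
      frechet_derivative (\<lambda>y. g y u) (at x) h + frechet_derivative (\<lambda>y. g y v) (at x) h"
    using linear_add[OF lin] by (simp add: frechet_derivative_at[symmetric])
next
  fix r :: real and v
  have "((\<lambda>y. r * g y v) has_derivative (\<lambda>h. r * frechet_derivative (\<lambda>y. g y v) (at x) h)) (at x)"
    using d by (intro has_derivative_mult_right) (auto simp: frechet_derivative_works[symmetric])
  then show "frechet_derivative (\<lambda>y. g y (r *\<^sub>R v)) (at x) h =
      r *\<^sub>R frechet_derivative (\<lambda>y. g y v) (at x) h"
    using linear_scale[OF lin] by (simp add: frechet_derivative_at[symmetric])
qed

text \<open>Multilinearity holds term by term: a slot is either an argument of the differentiated
  coefficient or the direction of differentiation.  On a list with a repeated entry \<open>a\<close>, only the
  two terms that differentiate along one of the copies of \<open>a\<close> survive.  Their remaining lists differ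
  by moving \<open>a\<close> past the entries between the copies, and the resulting sign makes them cancel.\<close>

lemma exterior_derivative_alternating:
  fixes \<omega> :: "('a, 'e::real_normed_vector) form"
  assumes alt: "\<And>y. \<omega> c y \<in> alternating_forms k"
    and d: "\<And>vs. (\<lambda>y. \<omega> c y vs) differentiable (at x)"
  shows "exterior_derivative \<omega> c x \<in> alternating_forms (Suc k)"
proof (cases "x \<in> chart_image c")
  case True
  define D where "D = (\<lambda>ws. frechet_derivative (\<lambda>y. \<omega> c y ws) (at x))"
  define del where "del = (\<lambda>i (vs::'e list). take i vs @ drop (Suc i) vs)"
  have ext: "exterior_derivative \<omega> c x vs = (\<Sum>i<length vs. (-1) ^ i * D (del i vs) (vs ! i))" for vs
    using True by (simp add: exterior_derivative_def D_def del_def)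
  have D0: "D ws = (\<lambda>_. 0)" if "\<And>y. \<omega> c y ws = 0" for ws
    using that by (simp add: D_def)
  have lin_slot: "linear (\<lambda>v. D (us @ v # ws) h)" if "length us + length ws + 1 = k" for us ws h
    unfolding D_def using alternating_forms_linear[OF alt that] d
    by (intro linear_frechet_derivative_of_family)
  have lin_dir: "linear (D ws)" for ws
    unfolding D_def using d linear_frechet_derivative by blast
  show ?thesis
    unfolding alternating_forms_def mem_Collect_eq
  proof (intro conjI allI impI)
    fix vs :: "'e list" assume "length vs \<noteq> Suc k"
    then have "length (del i vs) \<noteq> k" if "i < length vs" for i
      using that by (simp add: del_def min_def)
    then have "D (del i vs) = (\<lambda>_. 0)" if "i < length vs" for i
      using that by (intro D0 alternating_forms_length[OF alt]) auto
    then show "exterior_derivative \<omega> c x vs = 0" by (simp add: ext)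
  next
    fix us ws :: "'e list" assume len: "length us + length ws + 1 = Suc k"
    have "linear (\<lambda>v. \<Sum>i<Suc k. (-1) ^ i * D (del i (us @ v # ws)) ((us @ v # ws) ! i))"
    proof (rule linear_compose_sum, rule ballI)
      fix i assume "i \<in> {..<Suc k}"
      then have i: "i \<le> k" by simp
      consider "i < length us" | "i = length us" | "i > length us" by linarith
      then have "linear (\<lambda>v. D (del i (us @ v # ws)) ((us @ v # ws) ! i))"
      proof cases
        case 1
        then have "linear (\<lambda>v. D ((take i us @ drop (Suc i) us) @ v # ws) (us ! i))"
          using len by (intro lin_slot) simp
        then show ?thesis using 1 by (simp add: del_def nth_append Suc_le_eq)
      next
        case 2
        then show ?thesis using lin_dir by (simp add: del_def)
      next
        case 3
        then obtain j where j: "i = Suc (length us + j)" using less_iff_Suc_add by auto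
        have "linear (\<lambda>v. D (us @ v # (take j ws @ drop (Suc j) ws)) (ws ! j))"
          using len i j by (intro lin_slot) simp
        then show ?thesis by (simp add: del_def j nth_append)
      qed
      then show "linear (\<lambda>v. (-1) ^ i * D (del i (us @ v # ws)) ((us @ v # ws) ! i))"
        by (simp add: linear_iff algebra_simps)
    qed
    then show "linear (\<lambda>v. exterior_derivative \<omega> c x (us @ v # ws))"
      using len by (simp add: ext)
  next
    fix vs :: "'e list" assume "\<not> distinct vs"
    then obtain xs ys zs a where vs: "vs = xs @ a # ys @ a # zs"
      using not_distinct_decomp[of vs] by auto
    let ?i = "length xs" and ?j = "Suc (length xs + length ys)"
    have van: "D (del i vs) = (\<lambda>_. 0)" if i: "i \<noteq> ?i" "i \<noteq> ?j" for i
    proof -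
      have "\<not> distinct (del i vs)"
      proof -
        consider "i < ?i" | "?i < i" "i < ?j" | "i > ?j" using i by linarith
        then show ?thesis
        proof cases
          case 1
          then show ?thesis by (simp add: del_def vs Suc_le_eq)
        next
          case 2
          then obtain j where j: "i = Suc (?i + j)" "j < length ys"
            using less_iff_Suc_add[of ?i i] by auto
          then show ?thesis by (simp add: del_def vs)
        next
          case 3
          then obtain j where j: "i = Suc (?j + j)"
            using less_iff_Suc_add[of ?j i] by auto
          then show ?thesis by (simp add: del_def vs)
        qed
      qed
      then show ?thesis by (intro D0 alternating_forms_not_distinct[OF alt])
    qed
    have di: "del ?i vs = xs @ ys @ a # zs" "vs ! ?i = a"
      by (simp_all add: del_def vs)
    have dj: "del ?j vs = xs @ a # ys @ zs" "vs ! ?j = a"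
      by (simp_all add: del_def vs nth_append)
    have "((\<lambda>y. (-1) ^ length ys * \<omega> c y (del ?i vs)) has_derivative
        (\<lambda>h. (-1) ^ length ys * D (del ?i vs) h)) (at x)"
      unfolding D_def using d
      by (intro has_derivative_mult_right) (auto simp: frechet_derivative_works[symmetric])
    moreover have "(\<lambda>y. (-1) ^ length ys * \<omega> c y (del ?i vs)) = (\<lambda>y. \<omega> c y (del ?j vs))"
      unfolding di dj alternating_move[OF alt, of _ xs a ys zs] by simp
    ultimately have Dj: "D (del ?j vs) = (\<lambda>h. (-1) ^ length ys * D (del ?i vs) h)"
      unfolding D_def by (simp add: frechet_derivative_at[symmetric])
    have "exterior_derivative \<omega> c x vs
        = (\<Sum>i\<in>{?i, ?j}. (-1) ^ i * D (del i vs) (vs ! i))"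
      unfolding ext proof (rule sum.mono_neutral_right)
      show "{?i, ?j} \<subseteq> {..<length vs}" by (simp add: vs)
      show "\<forall>i\<in>{..<length vs} - {?i, ?j}. (-1) ^ i * D (del i vs) (vs ! i) = 0"
        by (simp add: van)
    qed simp
    also have "\<dots> = 0"
      by (simp add: di(2) dj(2) Dj power_add flip: power_mult_distrib)
    finally show "exterior_derivative \<omega> c x vs = 0" .
  qed
next
  case False
  then have "exterior_derivative \<omega> c x = (\<lambda>_. 0)" by (auto simp: exterior_derivative_def)
  then show ?thesis using zero_alternating by simp
qed

section \<open>Locality of the bracket\<close>

lemma forms_alternating:
  assumes "\<omega> \<in> forms A k"
  shows "\<omega> c x \<in> alternating_forms k"
proof (cases "c \<in> A \<and> x \<in> chart_image c")
  case True
  then show ?thesis using assms unfolding forms_def by blast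
next
  case False
  then have "\<omega> c x = (\<lambda>_. 0)" using assms unfolding forms_def by blast
  then show ?thesis using zero_alternating by simp
qed

lemma forms_differentiable:
  assumes "\<omega> \<in> forms A k" "c \<in> A" "x \<in> chart_image c"
  shows "(\<lambda>y. \<omega> c y vs) differentiable (at x)"
proof -
  have "Ck_on (Suc 0) (chart_image c) (\<lambda>y. \<omega> c y vs)"
    using assms unfolding forms_def smooth_on_def by blast
  then show ?thesis using assms(3) by simp
qed

lemma mvfields_multivectors:
  "U \<in> mvfields A p \<Longrightarrow> c \<in> A \<Longrightarrow> x \<in> chart_image c \<Longrightarrow> U c x \<in> multivectors p"
  by (auto simp: mvfields_def)

text \<open>A chart maps the part of its domain off the closed set \<open>support M A \<alpha>\<close> onto an open set of
  coordinates where \<open>\<alpha>\<close> vanishes, so a local hypothesis in single charts controls the support.\<close>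

lemma support_subset_if_locally_zero:
  assumes M: "smooth_manifold M A"
    and loc: "\<And>c N x. c \<in> A \<Longrightarrow> open N \<Longrightarrow> N \<subseteq> chart_image c \<Longrightarrow> x \<in> N \<Longrightarrow>
      (\<And>y. y \<in> N \<Longrightarrow> \<alpha> c y = (\<lambda>_. 0)) \<Longrightarrow> \<gamma> c x = (\<lambda>_. 0)"
  shows "support M A \<gamma> \<subseteq> support M A \<alpha>"
proof -
  have cl: "closedin M (support M A \<alpha>)" by (simp add: support_def)
  have "{m \<in> topspace M. \<exists>c\<in>A. m \<in> fst c \<and> \<gamma> c (snd c m) \<noteq> (\<lambda>_. 0)} \<subseteq> support M A \<alpha>"
  proof (rule subsetI, rule ccontr)
    fix m
    assume "m \<in> {m \<in> topspace M. \<exists>c\<in>A. m \<in> fst c \<and> \<gamma> c (snd c m) \<noteq> (\<lambda>_. 0)}"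
      and m: "m \<notin> support M A \<alpha>"
    then obtain c where c: "m \<in> topspace M" "c \<in> A" "m \<in> fst c" "\<gamma> c (snd c m) \<noteq> (\<lambda>_. 0)"
      by auto
    have chart: "chart_on M c" using M c(2) by (simp add: smooth_manifold_def)
    define T where "T = fst c - support M A \<alpha>"
    have "openin M T" unfolding T_def using chart cl
      by (intro openin_diff) (simp_all add: chart_on_def)
    then have "openin (subtopology M (fst c)) T"
      unfolding openin_subtopology T_def by auto
    then have "openin (top_of_set (chart_image c)) (snd c ` T)"
      using chart homeomorphic_imp_open_map open_map_def unfolding chart_on_def by blast
    then have op: "open (snd c ` T)"
      using chart openin_open_trans unfolding chart_on_def by blast
    have z: "\<alpha> c y = (\<lambda>_. 0)" if "y \<in> snd c ` T" for y
    proof -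
      from that obtain m' where m': "m' \<in> T" "y = snd c m'" by auto
      have "m' \<in> topspace M"
        using \<open>openin M T\<close> m'(1) openin_subset by blast
      moreover have "{m \<in> topspace M. \<exists>c\<in>A. m \<in> fst c \<and> \<alpha> c (snd c m) \<noteq> (\<lambda>_. 0)} \<subseteq> support M A \<alpha>"
        unfolding support_def by (rule closure_of_subset) auto
      ultimately show ?thesis using m' c(2) by (auto simp: T_def)
    qed
    have "\<gamma> c (snd c m) = (\<lambda>_. 0)"
      by (rule loc[OF c(2) op _ _ z]) (use c m in \<open>auto simp: T_def chart_image_def\<close>)
    with c(4) show False by simp
  qed
  then show ?thesis
    unfolding support_def[of M A \<gamma>] by (rule closure_of_minimal[OF _ cl])
qed

lemma lie_derivative_interior_product_zero:
  assumes X: "X \<in> mvfields A p" and c: "c \<in> A"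
    and N: "open N" "N \<subseteq> chart_image c" "x \<in> N" and z: "\<And>y. y \<in> N \<Longrightarrow> \<omega> c y = (\<lambda>_. 0)"
  shows "lie_derivative p X \<omega> c x = (\<lambda>_. 0)"
proof -
  have X': "X c y \<in> multivectors p" if "y \<in> N" for y
    using mvfields_multivectors[OF X c] N(2) that by blast
  have "exterior_derivative (interior_product p X \<omega>) c x = (\<lambda>_. 0)"
    by (rule exterior_derivative_local_zero[OF N(1,3)])
      (simp add: interior_product_contract z contract_zero[OF X'])
  moreover have "interior_product p X (exterior_derivative \<omega>) c x = (\<lambda>_. 0)"
    using exterior_derivative_local_zero[of N x \<omega> c, OF N(1,3) z]
    by (simp add: interior_product_contract contract_zero[OF X'[OF N(3)]])
  ultimately show ?thesis by (simp add: lie_derivative_def)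
qed

text \<open>The case \<open>\<beta> = 0\<close>: both terms of \<open>\<iota>\<^bsub>[X,Y]\<^esub> \<Theta>\<close> vanish separately.  Conformality of
  \<open>X\<close> turns \<open>\<L>\<^sub>X \<Theta>\<close> into a contraction of \<open>\<Theta>\<close>, past which \<open>\<iota>\<^sub>Y\<close> can be commuted.\<close>

lemma schouten_contraction_zero_right:
  assumes \<Theta>: "\<Theta> \<in> forms A n" and X: "X \<in> mvfields A p" and Y: "Y \<in> mvfields A q"
    and V: "V \<in> mvfields A r" "lie_derivative p X \<Theta> = interior_product r V \<Theta>"
    and W: "schouten_bracket A p q X Y W"
    and c: "c \<in> A" and N: "open N" "N \<subseteq> chart_image c" "x \<in> N"
    and z: "\<And>y. y \<in> N \<Longrightarrow> interior_product q Y \<Theta> c y = (\<lambda>_. 0)"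
  shows "interior_product (p + q - 1) W \<Theta> c x = (\<lambda>_. 0)"
proof
  fix vs
  have x: "x \<in> chart_image c" using N by auto
  have "interior_product q Y (interior_product r V \<Theta>) c x vs
      = (-1) ^ (q * r) * interior_product r V (interior_product q Y \<Theta>) c x vs"
    unfolding interior_product_contract
    using contract_graded_commute mvfields_multivectors[OF _ c x] Y V(1) forms_alternating[OF \<Theta>]
    by blast
  also have "interior_product r V (interior_product q Y \<Theta>) c x vs = 0"
    by (simp add: interior_product_contract[of r] z[OF N(3)]
        contract_zero[OF mvfields_multivectors[OF V(1) c x]])
  finally have "interior_product q Y (lie_derivative p X \<Theta>) c x vs = 0"
    by (simp add: V(2))
  moreover have "lie_derivative p X (interior_product q Y \<Theta>) c x vs = 0"
    using lie_derivative_interior_product_zero[where \<omega> = "interior_product q Y \<Theta>", OF X c N z] by simp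
  ultimately show "interior_product (p + q - 1) W \<Theta> c x vs = 0"
    using W \<Theta> by (simp add: schouten_bracket_def)
qed

text \<open>The case \<open>\<alpha> = 0\<close>: the two terms of \<open>\<iota>\<^bsub>[X,Y]\<^esub> \<Theta>\<close> cancel.  Conformality of \<open>Y\<close>
  replaces \<open>d\<iota>\<^sub>Y \<Theta>\<close>, which is not controlled by \<open>\<alpha>\<close>, by contractions of \<open>\<Theta>\<close>
  and \<open>d\<Theta>\<close>, which commute with \<open>\<iota>\<^sub>X\<close> up to sign.\<close>

lemma schouten_contraction_zero_left:
  assumes \<Theta>: "\<Theta> \<in> forms A n" and X: "X \<in> mvfields A p" and Y: "Y \<in> mvfields A q"
    and pq: "1 \<le> p" "1 \<le> q"
    and V: "V \<in> mvfields A (q - 1)" "lie_derivative q Y \<Theta> = interior_product (q - 1) V \<Theta>"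
    and W: "schouten_bracket A p q X Y W"
    and c: "c \<in> A" and N: "open N" "N \<subseteq> chart_image c" "x \<in> N"
    and z: "\<And>y. y \<in> N \<Longrightarrow> interior_product p X \<Theta> c y = (\<lambda>_. 0)"
  shows "interior_product (p + q - 1) W \<Theta> c x = (\<lambda>_. 0)"
proof
  fix vs
  have x: "x \<in> chart_image c" using N by auto
  note mv = mvfields_multivectors[OF _ c]
  note alt = forms_alternating[OF \<Theta>]
  let ?d = "exterior_derivative \<Theta> c x"
  have dalt: "?d \<in> alternating_forms (Suc n)"
    by (rule exterior_derivative_alternating[where \<omega> = \<Theta>, OF alt forms_differentiable[OF \<Theta> c x]])
  \<comment> \<open>The summand 0 gives the expression the shape of a linear combination of alternating forms.\<close>
  have LX: "lie_derivative p X \<Theta> c x = (\<lambda>us. 0 + (- ((-1) ^ p)) * contract p (X c x) ?d us)"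
    using exterior_derivative_local_zero[of N x "interior_product p X \<Theta>" c, OF N(1,3) z]
    by (simp add: lie_derivative_def interior_product_contract)
  have YLX: "interior_product q Y (lie_derivative p X \<Theta>) c x vs
      = - ((-1) ^ p) * contract q (Y c x) (contract p (X c x) ?d) vs"
    unfolding interior_product_contract LX
    by (subst contract_add_scaled[OF mv[OF Y x] zero_alternating
          contract_alternating[OF mv[OF X x] dalt]])
      (simp add: contract_zero[OF mv[OF Y x]])
  have "interior_product p X (interior_product q Y \<Theta>) c y = (\<lambda>_. 0)" if "y \<in> N" for y
  proof
    fix us
    have y: "y \<in> chart_image c" using N(2) that by auto
    have "contract p (X c y) (contract q (Y c y) (\<Theta> c y)) us
        = (-1) ^ (p * q) * contract q (Y c y) (contract p (X c y) (\<Theta> c y)) us"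
      by (rule contract_graded_commute[OF mv[OF X y] mv[OF Y y] alt])
    then show "interior_product p X (interior_product q Y \<Theta>) c y us = 0"
      using z[OF that] by (simp add: interior_product_contract contract_zero[OF mv[OF Y y]])
  qed
  then have dXY: "exterior_derivative (interior_product p X (interior_product q Y \<Theta>)) c x vs = 0"
    using exterior_derivative_local_zero[OF N(1,3)] by metis
  have "lie_derivative q Y \<Theta> c x us = interior_product (q - 1) V \<Theta> c x us" for us
    by (simp add: V(2))
  then have dY: "exterior_derivative (interior_product q Y \<Theta>) c x
      = (\<lambda>us. contract (q - 1) (V c x) (\<Theta> c x) us + (-1) ^ q * contract q (Y c x) ?d us)"
    by (auto simp: lie_derivative_def interior_product_contract algebra_simps)
  have XV: "contract p (X c x) (contract (q - 1) (V c x) (\<Theta> c x)) vs = 0"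
    using contract_graded_commute[OF mv[OF X x] mv[OF V(1) x] alt, where vs = vs] z[OF N(3)]
    by (simp add: interior_product_contract contract_zero[OF mv[OF V(1) x], simplified])
  \<comment> \<open>The contractions of \<open>\<Theta>\<close> with \<open>V\<close> and of \<open>d\<Theta>\<close> with \<open>Y\<close> have the same degree.\<close>
  have "n - (q - 1) = Suc n - q" using pq by simp
  then have "contract (q - 1) (V c x) (\<Theta> c x) \<in> alternating_forms (Suc n - q)"
    using contract_alternating[OF mv[OF V(1) x] alt] by metis
  then have "interior_product p X (exterior_derivative (interior_product q Y \<Theta>)) c x vs
      = (-1) ^ q * contract p (X c x) (contract q (Y c x) ?d) vs"
    unfolding interior_product_contract[of p] dY
    by (subst contract_add_scaled[OF mv[OF X x] _ contract_alternating[OF mv[OF Y x] dalt]])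
      (simp_all add: XV[simplified])
  also have "\<dots> = (-1) ^ q * ((-1) ^ (p * q) * contract q (Y c x) (contract p (X c x) ?d) vs)"
    by (simp add: contract_graded_commute[OF mv[OF X x] mv[OF Y x] dalt])
  finally have LXY: "lie_derivative p X (interior_product q Y \<Theta>) c x vs
      = - ((-1) ^ (p + (q + p * q))) * contract q (Y c x) (contract p (X c x) ?d) vs"
    by (simp add: lie_derivative_def dXY power_add)
  \<comment> \<open>The sign in the normalization of the bracket is what makes the two terms equal.\<close>
  have "(p - 1) * q + (p + (q + p * q)) = p + 2 * (p * q)"
    using pq(1) by (cases p) (auto simp: algebra_simps)
  then have "(-1) ^ ((p - 1) * q) * (-1) ^ (p + (q + p * q)) = ((-1) ^ (p + 2 * (p * q)) :: real)"
    by (simp only: power_add[symmetric])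
  also have "\<dots> = (-1) ^ p"
    by (simp only: power_add power_mult) simp
  finally have sign: "(-1) ^ ((p - 1) * q) * (-1) ^ (p + (q + p * q)) = ((-1) ^ p :: real)" .
  have "s * (- t * u) = - r * u" if "s * t = r" for r s t u :: real
    using that by auto
  from this[OF sign] have "(-1) ^ ((p - 1) * q) * lie_derivative p X (interior_product q Y \<Theta>) c x vs
      = interior_product q Y (lie_derivative p X \<Theta>) c x vs"
    unfolding LXY YLX .
  then show "interior_product (p + q - 1) W \<Theta> c x vs = 0"
    using W \<Theta> by (simp add: schouten_bracket_def)
qed

theorem proposition2p12:
  fixes M :: "'a topology"
    and A :: "('a, 'e::real_normed_vector) chart set"
    and \<Theta> \<alpha> \<beta> \<gamma> :: "('a, 'e) form"
    and n a b :: nat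
  assumes "smooth_manifold M A"
    and "\<Theta> \<in> forms A n"
    and "conformal_hamiltonian A n \<Theta> a \<alpha>"
    and "conformal_hamiltonian A n \<Theta> b \<beta>"
    and "graded_jacobi_bracket A n \<Theta> a \<alpha> b \<beta> \<gamma>"
  shows "support M A \<gamma> \<subseteq> support M A \<alpha> \<inter> support M A \<beta>"
proof -
  obtain p q X Y W where
    X: "hamiltonian_mvfield A n \<Theta> p \<alpha> X" and Y: "hamiltonian_mvfield A n \<Theta> q \<beta> Y"
    and W: "schouten_bracket A p q X Y W"
    and \<gamma>: "\<gamma> = (\<lambda>c x vs. - interior_product (p + q - 1) W \<Theta> c x vs)"
    using assms(5) unfolding graded_jacobi_bracket_def by blast
  obtain V where p: "1 \<le> p" and X': "X \<in> mvfields A p"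
    and V: "V \<in> mvfields A (p - 1)" "lie_derivative p X \<Theta> = interior_product (p - 1) V \<Theta>"
    using X unfolding hamiltonian_mvfield_def infinitesimal_conformal_def by blast
  obtain V' where q: "1 \<le> q" and Y': "Y \<in> mvfields A q"
    and V': "V' \<in> mvfields A (q - 1)" "lie_derivative q Y \<Theta> = interior_product (q - 1) V' \<Theta>"
    using Y unfolding hamiltonian_mvfield_def infinitesimal_conformal_def by blast
  have \<alpha>: "interior_product p X \<Theta> = (\<lambda>c x vs. - \<alpha> c x vs)"
    using X by (simp add: hamiltonian_mvfield_def)
  have \<beta>: "interior_product q Y \<Theta> = (\<lambda>c x vs. - \<beta> c x vs)"
    using Y by (simp add: hamiltonian_mvfield_def)
  have "support M A \<gamma> \<subseteq> support M A \<alpha>"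
  proof (rule support_subset_if_locally_zero[OF assms(1)])
    fix c N x assume *: "c \<in> A" "open N" "N \<subseteq> chart_image c" "x \<in> N"
      "\<And>y. y \<in> N \<Longrightarrow> \<alpha> c y = (\<lambda>_. 0)"
    then have "interior_product (p + q - 1) W \<Theta> c x = (\<lambda>_. 0)"
      by (intro schouten_contraction_zero_left[OF assms(2) X' Y' p q V' W]) (auto simp: \<alpha>)
    then show "\<gamma> c x = (\<lambda>_. 0)" by (simp add: \<gamma>)
  qed
  moreover have "support M A \<gamma> \<subseteq> support M A \<beta>"
  proof (rule support_subset_if_locally_zero[OF assms(1)])
    fix c N x assume *: "c \<in> A" "open N" "N \<subseteq> chart_image c" "x \<in> N"
      "\<And>y. y \<in> N \<Longrightarrow> \<beta> c y = (\<lambda>_. 0)"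
    then have "interior_product (p + q - 1) W \<Theta> c x = (\<lambda>_. 0)"
      by (intro schouten_contraction_zero_right[OF assms(2) X' Y' V W]) (auto simp: \<beta>)
    then show "\<gamma> c x = (\<lambda>_. 0)" by (simp add: \<gamma>)
  qed
  ultimately show ?thesis by blast
qed

end
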